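(* An infinite abelian group acts as a Singer group on some projective plane if and only if it contains no involutions.
   Context: An involution is a group element of order exactly $2$. A projective plane is an axiomatic (not necessarily Desarguesian) projective plane. A group acts as a Singer group on a projective plane if it acts as a group of automorphisms (collineations) of the plane that is sharply transitive on its points (for any two points $x,y$ there is exactly one group element mapping $x$ to $y$). *)

theory Defs
  imports "HOL-Algebra.Algebra"
begin

locale projective_plane =
  fixes Points :: "'p set" and Lines :: "'l set" and incid :: "'p \<Rightarrow> 'l \<Rightarrow> bool"
  assumes unique_line:
      "\<lbrakk> p \<in> Points; q \<in> Points; p \<noteq> q \<rbrakk> \<Longrightarrow> \<exists>!l. l \<in> Lines \<and> incid p l \<and> incid q l"
    and unique_point:
      "\<lbrakk> l \<in> Lines; m \<in> Lines; l \<noteq> m \<rbrakk> \<Longrightarrow> \<exists>!p. p \<in> Points \<and> incid p l \<and> incid p m"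
    and quadrangle:
      "\<exists>Q \<subseteq> Points. card Q = 4 \<and> (\<forall>l \<in> Lines. card {p \<in> Q. incid p l} \<le> 2)"

text \<open>A collineation is given by its action on points; in a projective plane a line is determined
  by the points on it, so the accompanying bijection of the lines is unique.\<close>

definition collineation :: "'p set \<Rightarrow> 'l set \<Rightarrow> ('p \<Rightarrow> 'l \<Rightarrow> bool) \<Rightarrow> ('p \<Rightarrow> 'p) \<Rightarrow> bool" where
  "collineation P L incid f \<longleftrightarrow>
     bij_betw f P P \<and>
     (\<exists>h. bij_betw h L L \<and> (\<forall>p \<in> P. \<forall>l \<in> L. incid p l \<longleftrightarrow> incid (f p) (h l)))"

locale singer_action = group_action G P \<phi> + projective_plane P L incid
  for G (structure) and P :: "'p set" and L :: "'l set" and incid and \<phi> +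
  assumes collineations: "g \<in> carrier G \<Longrightarrow> collineation P L incid (\<phi> g)"
    and sharply_transitive:
      "\<lbrakk> x \<in> P; y \<in> P \<rbrakk> \<Longrightarrow> \<exists>!g. g \<in> carrier G \<and> \<phi> g x = y"

definition involution :: "('a, 'b) monoid_scheme \<Rightarrow> 'a \<Rightarrow> bool" where
  "involution G x \<longleftrightarrow> x \<in> carrier G \<and> group.ord G x = 2"

text \<open>HOL cannot quantify over types inside a formula. We therefore fix the type of group elements
  as the type of points and the type of sets of group elements as the type of lines. The lemma
  \<open>acts_as_singer_group_if\<close> below shows that this is no restriction: a Singer action
  on a plane over arbitrary types yields one over these types.\<close>

definition acts_as_singer_group :: "('a, 'b) monoid_scheme \<Rightarrow> bool" where
  "acts_as_singer_group G \<longleftrightarrow>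
     (\<exists>(P :: 'a set) (L :: 'a set set) incid \<phi>. singer_action G P L incid \<phi>)"

lemma acts_as_singer_group_if:
  fixes G :: "('a, 'b) monoid_scheme" and P :: "'p set" and L :: "'l set"
  assumes "singer_action G P L incid \<phi>"
  shows "acts_as_singer_group G"
proof -
  interpret S: singer_action G P L incid \<phi> by fact
  interpret H: group_hom G "BijGroup P" \<phi> by (rule S.group_hom)
  obtain Q where Q: "Q \<subseteq> P" "card Q = 4" "\<forall>l \<in> L. card {p \<in> Q. incid p l} \<le> 2"
    using S.quadrangle by auto
  then obtain p0 where p0: "p0 \<in> P" by fastforce
  define e where "e = (\<lambda>g. \<phi> g p0)"
  have eP: "e g \<in> P" if "g \<in> carrier G" for g
    using that p0 S.element_image unfolding e_def by blast
  have e_inj: "g = h" if "g \<in> carrier G" "h \<in> carrier G" "e g = e h" for g h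
    using S.sharply_transitive[OF p0 eP[OF that(1)]] that unfolding e_def by metis
  have e_surj: "\<exists>g \<in> carrier G. e g = p" if "p \<in> P" for p
    using S.sharply_transitive[OF p0 that] unfolding e_def by blast
  have e_mult: "e (g \<otimes>\<^bsub>G\<^esub> h) = \<phi> g (e h)" if "g \<in> carrier G" "h \<in> carrier G" for g h
    using S.composition_rule[OF p0 that] by (simp add: e_def)
  define t where "t = (\<lambda>l. {g \<in> carrier G. incid (e g) l})"
  define \<psi> where "\<psi> = (\<lambda>g. \<lambda>h \<in> carrier G. g \<otimes>\<^bsub>G\<^esub> h)"
  have plane: "projective_plane (carrier G) (t ` L) (\<in>)"
  proof
    fix p q assume pq: "p \<in> carrier G" "q \<in> carrier G" "p \<noteq> q"
    then have "\<exists>!l. l \<in> L \<and> incid (e p) l \<and> incid (e q) l"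
      using eP e_inj by (intro S.unique_line) blast+
    then show "\<exists>!l. l \<in> t ` L \<and> p \<in> l \<and> q \<in> l"
      using pq unfolding t_def by blast
  next
    fix l m assume "l \<in> t ` L" "m \<in> t ` L" "l \<noteq> m"
    then obtain l' m' where lm: "l' \<in> L" "m' \<in> L" "l = t l'" "m = t m'" "l' \<noteq> m'" by blast
    then obtain p where p: "p \<in> P" "incid p l'" "incid p m'"
      and uniq: "\<And>q. \<lbrakk>q \<in> P; incid q l'; incid q m'\<rbrakk> \<Longrightarrow> q = p"
      using S.unique_point[OF lm(1,2,5)] by blast
    obtain g where g: "g \<in> carrier G" "e g = p" using e_surj p by blast
    show "\<exists>!p. p \<in> carrier G \<and> p \<in> l \<and> p \<in> m"
    proof (rule ex1I[of _ g])
      show "g \<in> carrier G \<and> g \<in> l \<and> g \<in> m" using g p lm by (simp add: t_def)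
    next
      fix h assume "h \<in> carrier G \<and> h \<in> l \<and> h \<in> m"
      then show "h = g" using uniq[of "e h"] eP e_inj g lm by (auto simp: t_def)
    qed
  next
    define R where "R = {g \<in> carrier G. e g \<in> Q}"
    have inj: "inj_on e R" unfolding inj_on_def R_def using e_inj by blast
    have img: "e ` R = Q" unfolding R_def using e_surj Q(1) by blast
    have "card R = 4" using card_image[OF inj] img Q(2) by simp
    moreover have "card {p \<in> R. p \<in> t l} \<le> 2" if "l \<in> L" for l
    proof -
      have "e ` {p \<in> R. p \<in> t l} = {p \<in> Q. incid p l}"
        unfolding img[symmetric] by (auto simp: t_def R_def)
      moreover have "inj_on e {p \<in> R. p \<in> t l}" using inj by (rule inj_on_subset) blast
      ultimately have "card {p \<in> Q. incid p l} = card {p \<in> R. p \<in> t l}"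
        using card_image by fastforce
      then show ?thesis using Q(3)[rule_format, OF that] by (simp only:)
    qed
    ultimately show "\<exists>Q \<subseteq> carrier G. card Q = 4 \<and> (\<forall>l \<in> t ` L. card {p \<in> Q. p \<in> l} \<le> 2)"
      by (intro exI[of _ R]) (auto simp: R_def)
  qed
  have bij: "bij_betw (\<psi> g) (carrier G) (carrier G)" if g: "g \<in> carrier G" for g
    unfolding \<psi>_def bij_betw_def
  proof
    show "inj_on (\<lambda>h \<in> carrier G. g \<otimes>\<^bsub>G\<^esub> h) (carrier G)"
      using g by (auto simp: inj_on_def)
    have "\<exists>k \<in> carrier G. h = g \<otimes>\<^bsub>G\<^esub> k" if "h \<in> carrier G" for h
      using g that by (intro bexI[of _ "inv\<^bsub>G\<^esub> g \<otimes>\<^bsub>G\<^esub> h"]) (auto simp: H.G.m_assoc[symmetric])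
    then show "(\<lambda>h \<in> carrier G. g \<otimes>\<^bsub>G\<^esub> h) ` carrier G = carrier G"
      using g by (auto simp: image_iff)
  qed
  have Bij: "\<psi> g \<in> Bij (carrier G)" if "g \<in> carrier G" for g
    using bij[OF that] by (simp add: Bij_def \<psi>_def)
  have "\<psi> (g \<otimes>\<^bsub>G\<^esub> h) = compose (carrier G) (\<psi> g) (\<psi> h)"
    if "g \<in> carrier G" "h \<in> carrier G" for g h
    using that by (auto simp: compose_def \<psi>_def H.G.m_assoc intro!: restrict_ext)
  then have "\<psi> \<in> hom G (BijGroup (carrier G))"
    using Bij by (auto simp: hom_def BijGroup_def)
  then have action: "group_action G (carrier G) \<psi>"
    by (intro group_action.intro group_hom.intro group_hom_axioms.intro group_BijGroup
        H.G.is_group)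
  have coll: "collineation (carrier G) (t ` L) (\<in>) (\<psi> g)" if g: "g \<in> carrier G" for g
  proof -
    obtain h where h: "bij_betw h L L" "\<And>p l. \<lbrakk>p \<in> P; l \<in> L\<rbrakk> \<Longrightarrow> incid p l \<longleftrightarrow> incid (\<phi> g p) (h l)"
      using S.collineations[OF g] unfolding collineation_def by blast
    have mem: "k \<in> t l \<longleftrightarrow> \<psi> g k \<in> t (h l)" if "k \<in> carrier G" "l \<in> L" for k l
      using that g eP[OF that(1)] h(2)[of "e k" l] e_mult[OF g that(1)] by (simp add: t_def \<psi>_def)
    have sub: "t l \<subseteq> carrier G" for l by (auto simp: t_def)
    have th: "\<psi> g ` t l = t (h l)" if "l \<in> L" for l
    proof
      show "\<psi> g ` t l \<subseteq> t (h l)" using mem that sub by blast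
      show "t (h l) \<subseteq> \<psi> g ` t l"
      proof
        fix k assume k: "k \<in> t (h l)"
        then obtain j where "j \<in> carrier G" "k = \<psi> g j"
          using bij[OF g] sub unfolding bij_betw_def by blast
        then show "k \<in> \<psi> g ` t l" using mem that k by blast
      qed
    qed
    have "bij_betw (image (\<psi> g)) (t ` L) (t ` L)"
      unfolding bij_betw_def
    proof
      show "inj_on (image (\<psi> g)) (t ` L)"
        using bij[OF g] sub unfolding bij_betw_def
        by (auto intro!: inj_onI simp: inj_on_image_eq_iff)
      have "image (\<psi> g) ` t ` L = t ` h ` L" using th by (auto simp: image_image)
      then show "image (\<psi> g) ` t ` L = t ` L" using h(1) by (simp add: bij_betw_def)
    qed
    moreover have "\<forall>k \<in> carrier G. \<forall>l \<in> t ` L. k \<in> l \<longleftrightarrow> \<psi> g k \<in> \<psi> g ` l"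
      using mem th by auto
    ultimately show ?thesis using bij[OF g] unfolding collineation_def by blast
  qed
  have sharp: "\<exists>!g. g \<in> carrier G \<and> \<psi> g x = y" if "x \<in> carrier G" "y \<in> carrier G" for x y
  proof (rule ex1I[of _ "y \<otimes>\<^bsub>G\<^esub> inv\<^bsub>G\<^esub> x"])
    show "y \<otimes>\<^bsub>G\<^esub> inv\<^bsub>G\<^esub> x \<in> carrier G \<and> \<psi> (y \<otimes>\<^bsub>G\<^esub> inv\<^bsub>G\<^esub> x) x = y"
      using that by (simp add: \<psi>_def H.G.m_assoc)
  next
    fix g assume "g \<in> carrier G \<and> \<psi> g x = y"
    then show "g = y \<otimes>\<^bsub>G\<^esub> inv\<^bsub>G\<^esub> x"
      using that by (auto simp: \<psi>_def H.G.m_assoc)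
  qed
  have "singer_action G (carrier G) (t ` L) (\<in>) \<psi>"
    by (intro singer_action.intro action plane singer_action_axioms.intro coll sharp)
  then show ?thesis unfolding acts_as_singer_group_def by blast
qed

end

theory Submission
  imports Defs
begin

text \<open>If an involution \<open>t\<close> lies in a Singer group, it moves every point \<open>x\<close> and swaps \<open>x\<close> with
  \<open>t x\<close>, so it fixes the line joining them: every point lies on a fixed line. Two distinct fixed
  lines would meet in a fixed point, so there is only one fixed line and it contains all points,
  which contradicts the quadrangle axiom (\<open>singer_group_no_involution\<close>).

  Conversely, let \<open>G\<close> be infinite abelian without involutions. Suppose that \<open>D\<close> is a set in which
  every \<open>g \<noteq> \<one>\<close> is a quotient of two elements in exactly one way. Then the elements of \<open>G\<close> as points
  and the translates of \<open>D\<close> as lines form a projective plane on which \<open>G\<close> acts by translation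
  (\<open>perfect_difference_set_singer_action\<close>): commutativity makes the condition that two points lie on
  a unique translate and the condition that two translates meet in a unique point the same
  condition on \<open>D\<close>.

  Such a \<open>D\<close> is built by transfinite recursion along a well-order of \<open>G\<close> of minimal order type
  (\<open>perfect_difference_set_exists\<close>). The invariant is that no quotient is represented twice, that
  is, that the set built so far is a Sidon set; stage \<open>g\<close> provides a representation of \<open>g\<close> by adding
  a pair \<open>x\<close>, \<open>x \<otimes> g\<close> when there is none yet. A choice of \<open>x\<close> violates the invariant only if \<open>x\<close> or
  \<open>x \<otimes> x\<close> equals one of fewer than \<open>|G|\<close> products of old elements
  (\<open>sidon_insert_translated_pair\<close>). This is where involutions matter: without them squaring is
  injective, so fewer than \<open>|G|\<close> choices of \<open>x\<close> are excluded, and \<open>g\<close> differs from its inverse, so the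
  new pair does not represent the same quotient twice.\<close>

section \<open>Involutions in Singer groups\<close>

lemma singer_group_no_involution:
  assumes "singer_action G P L incid \<phi>"
  shows "\<not> involution G t"
proof
  assume inv: "involution G t"
  interpret S: singer_action G P L incid \<phi> by fact
  interpret H: group_hom G "BijGroup P" \<phi> by (rule S.group_hom)
  have t: "t \<in> carrier G" "H.G.ord t = 2" using inv by (auto simp: involution_def)
  have sq: "t \<otimes>\<^bsub>G\<^esub> t = \<one>\<^bsub>G\<^esub>"
    using H.G.pow_ord_eq_1[OF t(1)] t by (simp add: numeral_2_eq_2)
  have ne: "t \<noteq> \<one>\<^bsub>G\<^esub>" using t H.G.ord_id by auto
  have one: "\<phi> \<one>\<^bsub>G\<^esub> x = x" if "x \<in> P" for x
    using S.id_eq_one that by (metis restrict_apply')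
  have tP: "\<phi> t x \<in> P" if "x \<in> P" for x using S.element_image[OF t(1) that] by blast
  \<comment> \<open>By sharp transitivity only the identity of the group has a fixed point.\<close>
  have move: "\<phi> t x \<noteq> x" if "x \<in> P" for x
    using S.sharply_transitive[OF that that] one[OF that] t(1) ne by blast
  have twice: "\<phi> t (\<phi> t x) = x" if "x \<in> P" for x
    using S.composition_rule[OF that t(1) t(1)] sq one[OF that] by simp
  obtain h where h: "bij_betw h L L" "\<And>p l. \<lbrakk>p \<in> P; l \<in> L\<rbrakk> \<Longrightarrow> incid p l \<longleftrightarrow> incid (\<phi> t p) (h l)"
    using S.collineations[OF t(1)] unfolding collineation_def by blast
  have hL: "h l \<in> L" if "l \<in> L" for l using h(1) that by (auto simp: bij_betw_def)
  have line: "\<exists>l \<in> L. incid x l \<and> h l = l" if x: "x \<in> P" for x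
  proof -
    obtain l where l: "l \<in> L" "incid x l" "incid (\<phi> t x) l"
      using S.unique_line[OF x tP[OF x]] move[OF x] by metis
    have "incid (\<phi> t x) (h l)" "incid x (h l)"
      using h(2)[OF x l(1)] h(2)[OF tP[OF x] l(1)] l twice[OF x] by auto
    then have "h l = l"
      using S.unique_line[OF x tP[OF x]] move[OF x] l hL by metis
    then show ?thesis using l by blast
  qed
  have same: "l = m" if lm: "l \<in> L" "m \<in> L" "h l = l" "h m = m" for l m
  proof (rule ccontr)
    assume "l \<noteq> m"
    then obtain p where p: "p \<in> P" "incid p l" "incid p m"
      and uniq: "\<And>q. \<lbrakk>q \<in> P; incid q l; incid q m\<rbrakk> \<Longrightarrow> q = p"
      using S.unique_point[OF lm(1,2)] by blast
    have "incid (\<phi> t p) l" "incid (\<phi> t p) m"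
      using h(2)[OF p(1)] lm p by metis+
    then show False using uniq[OF tP[OF p(1)]] move[OF p(1)] by blast
  qed
  obtain Q where Q: "Q \<subseteq> P" "card Q = 4" "\<forall>l \<in> L. card {p \<in> Q. incid p l} \<le> 2"
    using S.quadrangle by auto
  then obtain x where "x \<in> Q" by fastforce
  then obtain l where l: "l \<in> L" "h l = l" using line Q(1) by blast
  have "{p \<in> Q. incid p l} = Q" using line same l Q(1) by blast
  then show False using Q l by fastforce
qed

section \<open>Sidon sets\<close>

context comm_group
begin

text \<open>The usual conclusion \<open>{a, b} = {c, d}\<close> follows by cancellation. Since \<open>a \<otimes> b = c \<otimes> d\<close> says that
  the quotients of \<open>a\<close> by \<open>c\<close> and of \<open>d\<close> by \<open>b\<close> agree, a Sidon set is one in which every element other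
  than \<open>\<one>\<close> is a quotient in at most one way. The multiplicative form avoids inverses.\<close>

definition sidon :: "'a set \<Rightarrow> bool" where
  "sidon D \<longleftrightarrow> (\<forall>a \<in> D. \<forall>b \<in> D. \<forall>c \<in> D. \<forall>d \<in> D. a \<otimes> b = c \<otimes> d \<longrightarrow> a = c \<or> a = d)"

lemma sidonD:
  "\<lbrakk>sidon D; a \<otimes> b = c \<otimes> d; a \<in> D; b \<in> D; c \<in> D; d \<in> D\<rbrakk> \<Longrightarrow> a = c \<or> a = d"
  unfolding sidon_def by blast

text \<open>A violation of the Sidon property involves only four elements, which lie together in one member
  of the chain. This is the limit step of the recursion.\<close>

lemma sidon_Union_chain:
  assumes chain: "\<And>A B. \<lbrakk>A \<in> \<C>; B \<in> \<C>\<rbrakk> \<Longrightarrow> A \<subseteq> B \<or> B \<subseteq> A"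
    and sidon: "\<And>A. A \<in> \<C> \<Longrightarrow> sidon A"
  shows "sidon (\<Union>\<C>)"
  unfolding sidon_def
proof (intro ballI impI)
  fix a b c d
  assume abcd: "a \<in> \<Union>\<C>" "b \<in> \<Union>\<C>" "c \<in> \<Union>\<C>" "d \<in> \<Union>\<C>" and eq: "a \<otimes> b = c \<otimes> d"
  have join: "\<exists>C \<in> \<C>. A \<subseteq> C \<and> B \<subseteq> C" if "A \<in> \<C>" "B \<in> \<C>" for A B
    using chain[OF that] that by blast
  have two: "\<exists>C \<in> \<C>. x \<in> C \<and> y \<in> C" if xy: "x \<in> \<Union>\<C>" "y \<in> \<Union>\<C>" for x y
  proof -
    obtain A B where "A \<in> \<C>" "x \<in> A" "B \<in> \<C>" "y \<in> B" using xy by blast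
    then show ?thesis using join[of A B] by blast
  qed
  obtain A where A: "A \<in> \<C>" "a \<in> A" "b \<in> A" using two[OF abcd(1,2)] by blast
  obtain B where B: "B \<in> \<C>" "c \<in> B" "d \<in> B" using two[OF abcd(3,4)] by blast
  obtain C where "C \<in> \<C>" "A \<subseteq> C" "B \<subseteq> C" using join[OF A(1) B(1)] by blast
  then show "a = c \<or> a = d" using sidonD[OF sidon eq] A B by blast
qed

text \<open>Up to exchanging factors and sides, the four elements of an equation \<open>a \<otimes> b = c \<otimes> d\<close> can be
  distributed over \<open>A\<close> and \<open>B\<close> in six ways: all in one of the sets, or one of the four mixed patterns
  of the last hypotheses. Each pattern constrains an added set \<open>B\<close> in a way that can be checked
  separately.\<close>

lemma sidon_Un:
  assumes sub: "A \<subseteq> carrier G" "B \<subseteq> carrier G" and sidon: "sidon A" "sidon B"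
    and AB: "\<And>a a' b b'. \<lbrakk>a \<in> A; a' \<in> A; b \<in> B; b' \<in> B; a \<otimes> b = a' \<otimes> b'\<rbrakk> \<Longrightarrow> a = a'"
    and AA: "\<And>a a' b b'. \<lbrakk>a \<in> A; a' \<in> A; b \<in> B; b' \<in> B\<rbrakk> \<Longrightarrow> a \<otimes> a' \<noteq> b \<otimes> b'"
    and AAB: "\<And>a a' a'' b. \<lbrakk>a \<in> A; a' \<in> A; a'' \<in> A; b \<in> B\<rbrakk> \<Longrightarrow> a \<otimes> a' \<noteq> a'' \<otimes> b"
    and BBA: "\<And>b b' b'' a. \<lbrakk>b \<in> B; b' \<in> B; b'' \<in> B; a \<in> A\<rbrakk> \<Longrightarrow> b \<otimes> b' \<noteq> b'' \<otimes> a"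
  shows "sidon (A \<union> B)"
  unfolding sidon_def
proof (intro ballI impI)
  fix a b c d
  assume abcd: "a \<in> A \<union> B" "b \<in> A \<union> B" "c \<in> A \<union> B" "d \<in> A \<union> B" and eq: "a \<otimes> b = c \<otimes> d"
  have G: "a \<in> carrier G" "b \<in> carrier G" "c \<in> carrier G" "d \<in> carrier G"
    using abcd sub by auto
  have eq': "a \<otimes> b = d \<otimes> c" "b \<otimes> a = c \<otimes> d" "b \<otimes> a = d \<otimes> c"
    using eq G by (simp_all add: m_comm)
  have cancel: "b = d \<Longrightarrow> a = c" "b = c \<Longrightarrow> a = d"
    using eq eq' G by (metis r_cancel)+
  have "a = c \<or> a = d" if "a \<in> A" "b \<in> A" "c \<in> A" "d \<in> A"
    using sidonD[OF sidon(1) eq] that by blast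
  moreover have "a = c \<or> a = d" if "a \<in> B" "b \<in> B" "c \<in> B" "d \<in> B"
    using sidonD[OF sidon(2) eq] that by blast
  moreover note AA[of a b c d] AA[of c d a b] AAB[of a b c d] AAB[of a b d c] AAB[of c d a b]
    AAB[of c d b a] BBA[of a b c d] BBA[of a b d c] BBA[of c d a b] BBA[of c d b a]
    AB[of a c b d] AB[of a d b c] AB[of b c a d] AB[of b d a c]
  moreover note eq eq' eq[symmetric] eq'[symmetric] cancel
  ultimately show "a = c \<or> a = d"
    using abcd unfolding Un_iff by argo
qed

lemma no_involution_iff:
  "(\<nexists>t. involution G t) \<longleftrightarrow> (\<forall>t \<in> carrier G. t \<otimes> t = \<one> \<longrightarrow> t = \<one>)"
proof -
  have "ord t = 2 \<longleftrightarrow> t \<otimes> t = \<one> \<and> t \<noteq> \<one>" if t: "t \<in> carrier G" for t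
  proof -
    have "t \<otimes> t = \<one> \<longleftrightarrow> ord t dvd 2"
      using pow_eq_id[OF t, of 2] t by (simp add: numeral_2_eq_2)
    moreover have "n dvd 2 \<longleftrightarrow> n = 1 \<or> n = 2" for n :: nat
      using prime_nat_iff[of 2] by auto
    ultimately show ?thesis using ord_eq_1[OF t] by auto
  qed
  then show ?thesis unfolding involution_def by blast
qed

lemma inj_on_square:
  assumes "\<nexists>t. involution G t"
  shows "inj_on (\<lambda>x. x \<otimes> x) (carrier G)"
proof (rule inj_onI)
  fix x y assume xy: "x \<in> carrier G" "y \<in> carrier G" "x \<otimes> x = y \<otimes> y"
  have "(x \<otimes> inv y) \<otimes> (x \<otimes> inv y) = (x \<otimes> x) \<otimes> inv (y \<otimes> y)"
    using xy(1,2) by (simp add: m_ac inv_mult)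
  also have "\<dots> = \<one>" using xy by simp
  finally have "x \<otimes> inv y = \<one>"
    using assms xy unfolding no_involution_iff by blast
  then show "x = y" using xy by (metis inv_closed inv_equality inv_inv)
qed

text \<open>The equation \<open>x \<otimes> x = (x \<otimes> g) \<otimes> (x \<otimes> g)\<close> is the one that could hold for \<open>g \<noteq> \<one>\<close>, and it would
  make \<open>g\<close> an involution.\<close>

lemma sidon_translated_pair:
  assumes "\<nexists>t. involution G t" "x \<in> carrier G" "g \<in> carrier G" "g \<noteq> \<one>"
  shows "sidon {x, x \<otimes> g}"
proof -
  have "x \<otimes> x \<noteq> (x \<otimes> g) \<otimes> (x \<otimes> g)"
    using inj_onD[OF inj_on_square[OF assms(1)], of x "x \<otimes> g"] assms by auto
  then show ?thesis using assms(2-4) unfolding sidon_def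
    by (auto simp: m_assoc)
qed

text \<open>Every element of \<open>D \<union> {x, x \<otimes> g}\<close> is an element of \<open>E\<close> or \<open>x\<close> times one of \<open>\<one>\<close>, \<open>g\<close>. An equation
  between two products in which \<open>x\<close> does not cancel therefore expresses \<open>x\<close> or \<open>x \<otimes> x\<close> as an element
  of \<open>W\<close>. If \<open>x\<close> cancels, what remains is an equation within one of the two Sidon sets or a
  representation of \<open>g\<close> as a quotient in \<open>D\<close>.\<close>

lemma sidon_insert_translated_pair:
  fixes D g defines "E \<equiv> D \<union> {\<one>, g}"
  defines "W \<equiv> {u \<otimes> v \<otimes> inv (w \<otimes> z) | u v w z. u \<in> E \<and> v \<in> E \<and> w \<in> E \<and> z \<in> E}"
  assumes noinv: "\<nexists>t. involution G t" and D: "D \<subseteq> carrier G" "sidon D"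
    and g: "g \<in> carrier G" "g \<noteq> \<one>" "\<And>a b. \<lbrakk>a \<in> D; b \<in> D\<rbrakk> \<Longrightarrow> a \<noteq> g \<otimes> b"
    and x: "x \<in> carrier G" "x \<notin> W" "x \<otimes> x \<notin> W"
  shows "sidon (D \<union> {x, x \<otimes> g})"
proof (rule sidon_Un)
  have EG: "e \<in> carrier G" if "e \<in> E" for e using that D g by (auto simp: E_def)
  \<comment> \<open>The form in which membership in \<open>W\<close> is used below, with \<open>y\<close> equal to \<open>x\<close> or \<open>x \<otimes> x\<close>.\<close>
  have solve: "y \<in> W" if "y \<otimes> (w \<otimes> z) = u \<otimes> v" "y \<in> carrier G"
    "u \<in> E" "v \<in> E" "w \<in> E" "z \<in> E" for y u v w z
  proof -
    have "y = u \<otimes> v \<otimes> inv (w \<otimes> z)"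
      using that EG by (simp add: inv_solve_right)
    then show ?thesis using that unfolding W_def by blast
  qed
  have DE: "a \<in> E" if "a \<in> D" for a using that by (simp add: E_def)
  have DG: "a \<in> carrier G" if "a \<in> D" for a using that D by blast
  have pairE: "\<exists>e \<in> {\<one>, g}. b = x \<otimes> e" if "b \<in> {x, x \<otimes> g}" for b
    using that x by auto
  have pE: "e \<in> E" if "e \<in> {\<one>, g}" for e using that by (auto simp: E_def)
  show "{x, x \<otimes> g} \<subseteq> carrier G" using x g by auto
  show "sidon {x, x \<otimes> g}" by (rule sidon_translated_pair[OF noinv x(1) g(1,2)])
  show "D \<subseteq> carrier G" "sidon D" by fact+
  {
    fix a a' b b' assume *: "a \<in> D" "a' \<in> D" "b \<in> {x, x \<otimes> g}" "b' \<in> {x, x \<otimes> g}"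
      and eq: "a \<otimes> b = a' \<otimes> b'"
    have "a \<otimes> x = a' \<otimes> (x \<otimes> g) \<Longrightarrow> a = g \<otimes> a'" "a \<otimes> (x \<otimes> g) = a' \<otimes> x \<Longrightarrow> a' = g \<otimes> a"
      using DG[OF *(1)] DG[OF *(2)] x(1) g(1)
      by (metis m_comm m_lcomm l_cancel m_closed)+
    then show "a = a'"
      using * g(3) eq DG x(1) g(1) by (metis (full_types) empty_iff insert_iff m_closed r_cancel)
  next
    fix a a' b b' assume *: "a \<in> D" "a' \<in> D" "b \<in> {x, x \<otimes> g}" "b' \<in> {x, x \<otimes> g}"
    obtain e e' where e: "e \<in> {\<one>, g}" "e' \<in> {\<one>, g}" "b = x \<otimes> e" "b' = x \<otimes> e'"
      using pairE * by metis
    show "a \<otimes> a' \<noteq> b \<otimes> b'"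
    proof
      assume "a \<otimes> a' = b \<otimes> b'"
      then have "(x \<otimes> x) \<otimes> (e \<otimes> e') = a \<otimes> a'"
        using e x(1) pE EG by (simp add: m_ac)
      then show False using solve[of "x \<otimes> x" e e' a a'] x pE DE e * by blast
    qed
  next
    fix a a' a'' b assume *: "a \<in> D" "a' \<in> D" "a'' \<in> D" "b \<in> {x, x \<otimes> g}"
    obtain e where e: "e \<in> {\<one>, g}" "b = x \<otimes> e" using pairE * by metis
    show "a \<otimes> a' \<noteq> a'' \<otimes> b"
    proof
      assume "a \<otimes> a' = a'' \<otimes> b"
      then have "x \<otimes> (a'' \<otimes> e) = a \<otimes> a'"
        using e x(1) pE EG DG * by (simp add: m_ac)
      then show False using solve[of x a'' e a a'] x pE DE e * by blast
    qed
  next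
    fix b b' b'' a assume *: "b \<in> {x, x \<otimes> g}" "b' \<in> {x, x \<otimes> g}" "b'' \<in> {x, x \<otimes> g}" "a \<in> D"
    obtain e e' e'' where e: "e \<in> {\<one>, g}" "e' \<in> {\<one>, g}" "e'' \<in> {\<one>, g}"
      "b = x \<otimes> e" "b' = x \<otimes> e'" "b'' = x \<otimes> e''"
      using pairE * by metis
    have eG: "e \<in> carrier G" "e' \<in> carrier G" "e'' \<in> carrier G" using e pE EG by auto
    show "b \<otimes> b' \<noteq> b'' \<otimes> a"
    proof
      assume "b \<otimes> b' = b'' \<otimes> a"
      then have "x \<otimes> (x \<otimes> (e \<otimes> e')) = x \<otimes> (e'' \<otimes> a)"
        using e eG x(1) DG[OF *(4)] by (simp add: m_ac)
      then have "x \<otimes> (e \<otimes> e') = e'' \<otimes> a"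
        using eG x(1) DG[OF *(4)] by simp
      then show False using solve[of x e e' e'' a] x pE DE e * by blast
    qed
  }
qed

section \<open>Extending small Sidon sets\<close>

unbundle cardinal_syntax

text \<open>The bounds below are strict, so finite sets need a case of their own: their squares and
  finite unions grow, but stay finite and hence below the infinite set \<open>C\<close>. For infinite sets the
  cardinality does not grow at all.\<close>

lemma card_of_Times_ordLess:
  assumes "infinite C" "|A| <o |C|"
  shows "|A \<times> A| <o |C|"
proof (cases "finite A")
  case True
  then show ?thesis using assms(1) by (intro finite_ordLess_infinite) auto
next
  case False
  then show ?thesis using card_of_Times_same_infinite assms(2) ordIso_ordLess_trans by blast
qed

lemma card_of_UN_finite_ordLess:
  assumes "infinite C" "|I| <o |C|" "\<And>i. i \<in> I \<Longrightarrow> finite (F i)"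
  shows "|\<Union>i \<in> I. F i| <o |C|"
proof (cases "finite I")
  case True
  then show ?thesis using assms by (intro finite_ordLess_infinite) auto
next
  case False
  have "|F i| \<le>o |I|" if "i \<in> I" for i
    using finite_ordLess_infinite[of "|F i|" "|I|"] assms(3)[OF that] False
    by (intro ordLess_imp_ordLeq) auto
  then have "|\<Union>i \<in> I. F i| \<le>o |I|"
    using False by (intro card_of_UNION_ordLeq_infinite) auto
  then show ?thesis using assms(2) by (rule ordLeq_ordLess_trans)
qed

text \<open>The successor step of the recursion, by counting: the excluded elements are those of \<open>W\<close>, an image
  of the fourth power of \<open>D \<union> {\<one>, g}\<close>, and the square roots of elements of \<open>W\<close>, of which each has
  at most one. Together they do not exhaust \<open>G\<close>.\<close>

lemma sidon_extend:
  assumes inf: "infinite (carrier G)" and noinv: "\<nexists>t. involution G t"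
    and D: "D \<subseteq> carrier G" "sidon D" "|D| <o |carrier G|"
    and g: "g \<in> carrier G" "g \<noteq> \<one>"
  shows "\<exists>Y. finite Y \<and> Y \<subseteq> carrier G \<and> sidon (D \<union> Y) \<and> (\<exists>a \<in> D \<union> Y. \<exists>b \<in> D \<union> Y. a = g \<otimes> b)"
proof (cases "\<exists>a \<in> D. \<exists>b \<in> D. a = g \<otimes> b")
  case True
  then show ?thesis using D by (intro exI[of _ "{}"]) auto
next
  case False
  define E where "E = D \<union> {\<one>, g}"
  define W where "W = {u \<otimes> v \<otimes> inv (w \<otimes> z) | u v w z. u \<in> E \<and> v \<in> E \<and> w \<in> E \<and> z \<in> E}"
  define sq where "sq = (\<lambda>x. x \<otimes> x)"
  define V where "V = {x \<in> carrier G. sq x \<in> W}"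
  have "|E| <o |carrier G|"
    unfolding E_def by (rule card_of_Un_ordLess_infinite[OF inf D(3)])
      (use inf in \<open>auto intro: finite_ordLess_infinite\<close>)
  then have E4: "|(E \<times> E) \<times> (E \<times> E)| <o |carrier G|"
    by (intro card_of_Times_ordLess inf)
  have "W = (\<lambda>((u, v), (w, z)). u \<otimes> v \<otimes> inv (w \<otimes> z)) ` ((E \<times> E) \<times> (E \<times> E))"
    unfolding W_def by force
  then have W: "|W| <o |carrier G|"
    using ordLeq_ordLess_trans[OF card_of_image E4] by metis
  have "inj_on sq V" "sq ` V \<subseteq> W"
    using inj_on_square[OF noinv] unfolding V_def sq_def by (auto elim: inj_on_subset)
  then have "|V| \<le>o |W|" using card_of_ordLeq by blast
  then have "|V| <o |carrier G|" using W by (rule ordLeq_ordLess_trans)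
  with W have "|W \<union> V| <o |carrier G|" by (rule card_of_Un_ordLess_infinite[OF inf])
  then have "\<not> carrier G \<subseteq> W \<union> V"
    using card_of_mono1 not_ordLess_ordLeq by blast
  then obtain x where x: "x \<in> carrier G" "x \<notin> W" "x \<otimes> x \<notin> W"
    unfolding V_def sq_def by blast
  have "sidon (D \<union> {x, x \<otimes> g})"
    using sidon_insert_translated_pair[OF noinv D(1,2) g _ x[unfolded W_def E_def]] False by blast
  then show ?thesis
    using x g by (intro exI[of _ "{x, x \<otimes> g}"]) (auto simp: m_comm)
qed

section \<open>Perfect difference sets\<close>

text \<open>The second clause says that \<open>g\<close> is a quotient of elements of \<open>D\<close> in exactly one way: \<open>b\<close> is the
  denominator and \<open>g \<otimes> b\<close> the numerator.\<close>

definition perfect_difference_set :: "'a set \<Rightarrow> bool" where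
  "perfect_difference_set D \<longleftrightarrow>
     D \<subseteq> carrier G \<and> (\<forall>g \<in> carrier G - {\<one>}. \<exists>!b. b \<in> D \<and> g \<otimes> b \<in> D)"

text \<open>Two representations of \<open>g\<close>, with denominators \<open>b\<close> and \<open>c\<close>, give the equation
  \<open>c \<otimes> (g \<otimes> b) = b \<otimes> (g \<otimes> c)\<close>, which the Sidon property resolves.\<close>

lemma sidon_imp_perfect_difference_set:
  assumes D: "D \<subseteq> carrier G" "sidon D"
    and ex: "\<And>g. \<lbrakk>g \<in> carrier G; g \<noteq> \<one>\<rbrakk> \<Longrightarrow> \<exists>a \<in> D. \<exists>b \<in> D. a = g \<otimes> b"
  shows "perfect_difference_set D"
  unfolding perfect_difference_set_def
proof (intro conjI ballI)
  fix g assume g: "g \<in> carrier G - {\<one>}"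
  then obtain b where b: "b \<in> D" "g \<otimes> b \<in> D" using ex by blast
  show "\<exists>!b. b \<in> D \<and> g \<otimes> b \<in> D"
  proof (rule ex1I[of _ b])
    fix c assume c: "c \<in> D \<and> g \<otimes> c \<in> D"
    have G: "b \<in> carrier G" "c \<in> carrier G" "g \<in> carrier G" using b c g D by auto
    have "c \<otimes> (g \<otimes> b) = b \<otimes> (g \<otimes> c)" using G by (simp add: m_ac)
    then have "c = b \<or> c = g \<otimes> c" using sidonD[OF D(2)] b c by blast
    then show "c = b" using G g r_cancel_one'[of c g] by auto
  qed (use b in blast)
qed fact

text \<open>In the cardinal order on \<open>G\<close> every proper initial segment is smaller than \<open>G\<close>. Since each stage adds
  finitely many elements, the set built before any stage is small enough for \<open>sidon_extend\<close>.\<close>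

lemma perfect_difference_set_exists:
  assumes inf: "infinite (carrier G)" and noinv: "\<nexists>t. involution G t"
  shows "\<exists>D. perfect_difference_set D"
proof -
  define r where "r = |carrier G|"
  have r: "Card_order r" "Well_order r" and field: "Field r = carrier G"
    unfolding r_def by auto
  have wf: "wf (r - Id)" using r(2) by (simp add: well_order_on_def)
  define before where "before = (\<lambda>(f :: 'a \<Rightarrow> 'a set) g. \<Union>h \<in> underS r g. f h)"
  \<comment> \<open>\<open>good f g Y\<close>: adding \<open>Y\<close> at stage \<open>g\<close>, after \<open>f\<close> was followed at all earlier stages, keeps the
      invariant and provides a representation of \<open>g\<close>. Outside the group nothing is required, because
      the recursion runs over the whole type.\<close>
  define good where "good = (\<lambda>f g Y. g \<in> carrier G \<longrightarrow> finite Y \<and> Y \<subseteq> carrier G \<and>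
    sidon (before f g \<union> Y) \<and>
    (g \<noteq> \<one> \<longrightarrow> (\<exists>a \<in> before f g \<union> Y. \<exists>b \<in> before f g \<union> Y. a = g \<otimes> b)))"
  have mem: "h \<in> underS r g \<longleftrightarrow> (h, g) \<in> r - Id" for g h by (auto simp: underS_def)
  have underG: "h \<in> carrier G" if "h \<in> underS r g" for g h
    using that field by (auto simp: underS_def Field_def)
  have linear: "h = k \<or> h \<in> underS r k \<or> k \<in> underS r h" if "h \<in> carrier G" "k \<in> carrier G" for h k
    using r(2) that field unfolding well_order_on_def linear_order_on_def total_on_def
    by (auto simp: underS_def)
  have trans: "underS r h \<subseteq> underS r k" if "h \<in> underS r k" for h k
    using r(2) that unfolding well_order_on_def linear_order_on_def partial_order_on_def
      preorder_on_def
    by (auto simp: underS_def dest: transD antisymD)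
  have mono: "before f h \<union> f h \<subseteq> before f k" if "h \<in> underS r k" for f h k
    using trans[OF that] that by (auto simp: before_def)
  have chain: "before f h \<union> f h \<subseteq> before f k \<union> f k \<or> before f k \<union> f k \<subseteq> before f h \<union> f h"
    if "h \<in> carrier G" "k \<in> carrier G" for f h k
    using linear[OF that] mono by blast
  \<comment> \<open>Used twice: for the set built before a stage, and for the final set.\<close>
  have union: "sidon (\<Union>h \<in> I. before f h \<union> f h)"
    if "I \<subseteq> carrier G" "\<And>h. h \<in> I \<Longrightarrow> good f h (f h)" for f I
  proof (rule sidon_Union_chain)
    fix A B assume "A \<in> (\<lambda>h. before f h \<union> f h) ` I" "B \<in> (\<lambda>h. before f h \<union> f h) ` I"
    then show "A \<subseteq> B \<or> B \<subseteq> A" using chain[where f = f] that(1) by (auto simp del: Un_subset_iff)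
  next
    fix A assume "A \<in> (\<lambda>h. before f h \<union> f h) ` I"
    then show "sidon A" using that unfolding good_def by blast
  qed
  have "\<exists>f. \<forall>g. good f g (f g)"
  proof (rule dependent_wf_choice[OF wf])
    fix f f' :: "'a \<Rightarrow> 'a set" and g Y
    assume "\<And>h. (h, g) \<in> r - Id \<Longrightarrow> f h = f' h"
    then have "before f g = before f' g" unfolding before_def by (intro SUP_cong refl) (simp add: mem)
    then show "good f g Y = good f' g Y" by (simp add: good_def)
  next
    fix g f assume IH: "\<And>h. (h, g) \<in> r - Id \<Longrightarrow> good f h (f h)"
    show "\<exists>Y. good f g Y"
    proof (cases "g \<in> carrier G")
      case True
      have good: "good f h (f h)" if "h \<in> underS r g" for h using IH that by (simp add: mem)
      have "before f g = (\<Union>h \<in> underS r g. before f h \<union> f h)"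
        using mono[of _ g f] by (auto simp: before_def)
      then have sidon: "sidon (before f g)" using union[of "underS r g" f] underG good by auto
      have sub: "before f g \<subseteq> carrier G"
        using good underG unfolding before_def good_def by blast
      have "|underS r g| <o |carrier G|"
        using card_of_underS[OF r(1)] True field by (simp add: r_def)
      then have small: "|before f g| <o |carrier G|"
        unfolding before_def
        by (rule card_of_UN_finite_ordLess[OF inf]) (use good underG in \<open>auto simp: good_def\<close>)
      show ?thesis
      proof (cases "g = \<one>")
        case True
        then show ?thesis using sidon by (intro exI[of _ "{}"]) (simp add: good_def)
      next
        case False
        then show ?thesis
          using sidon_extend[OF inf noinv sub sidon small \<open>g \<in> carrier G\<close>] unfolding good_def by blast
      qed
    qed (simp add: good_def)
  qed
  then obtain f where f: "\<And>g. good f g (f g)" by blast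
  define D where "D = (\<Union>h \<in> carrier G. before f h \<union> f h)"
  have sidon: "sidon D" unfolding D_def using union[of "carrier G" f] f by blast
  have sub: "D \<subseteq> carrier G"
    using f underG unfolding D_def before_def good_def by blast
  have ex: "\<exists>a \<in> D. \<exists>b \<in> D. a = g \<otimes> b" if "g \<in> carrier G" "g \<noteq> \<one>" for g
    using f[of g] that unfolding good_def D_def by blast
  show ?thesis
    by (rule exI[of _ D], rule sidon_imp_perfect_difference_set[OF sub sidon], rule ex)
qed

section \<open>The plane of a perfect difference set\<close>

lemma mem_l_coset_iff:
  assumes "D \<subseteq> carrier G" "x \<in> carrier G" "p \<in> carrier G"
  shows "p \<in> x <# D \<longleftrightarrow> inv x \<otimes> p \<in> D"
proof
  assume "p \<in> x <# D"
  then obtain d where "d \<in> D" "p = x \<otimes> d" by (auto simp: l_coset_def)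
  then show "inv x \<otimes> p \<in> D" using assms by (simp add: m_assoc[symmetric] subset_iff)
next
  assume "inv x \<otimes> p \<in> D"
  moreover have "p = x \<otimes> (inv x \<otimes> p)" using assms by (simp add: m_assoc[symmetric])
  ultimately show "p \<in> x <# D" unfolding l_coset_def by blast
qed

text \<open>The quotients of a finite set cannot exhaust an infinite group.\<close>

lemma perfect_difference_set_infinite:
  assumes "infinite (carrier G)" "perfect_difference_set D"
  shows "infinite D"
proof
  assume fin: "finite D"
  have D: "D \<subseteq> carrier G" and ex: "\<And>g. \<lbrakk>g \<in> carrier G; g \<noteq> \<one>\<rbrakk> \<Longrightarrow> \<exists>b. b \<in> D \<and> g \<otimes> b \<in> D"
    using assms(2) unfolding perfect_difference_set_def by blast+
  have "carrier G \<subseteq> insert \<one> ((\<lambda>(a, b). a \<otimes> inv b) ` (D \<times> D))"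
  proof
    fix g assume g: "g \<in> carrier G"
    show "g \<in> insert \<one> ((\<lambda>(a, b). a \<otimes> inv b) ` (D \<times> D))"
    proof (cases "g = \<one>")
      case False
      then obtain b where b: "b \<in> D" "g \<otimes> b \<in> D" using ex g by blast
      then have "g = g \<otimes> b \<otimes> inv b" using g D by (simp add: m_assoc subset_iff)
      then show ?thesis using b by force
    qed simp
  qed
  then show False using fin assms(1) by (meson finite_SigmaI finite_imageI finite_insert finite_subset)
qed

text \<open>A point \<open>p\<close> lies on both \<open>x <# D\<close> and \<open>y <# D\<close> iff \<open>b = inv x \<otimes> p\<close> and \<open>inv y \<otimes> p = g \<otimes> b\<close> are both in
  \<open>D\<close>, where \<open>g = inv y \<otimes> x\<close>; the line \<open>x <# D\<close> contains both \<open>p\<close> and \<open>q\<close> iff \<open>b = inv x \<otimes> p\<close> and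
  \<open>inv x \<otimes> q = g \<otimes> b\<close> are both in \<open>D\<close>, where \<open>g = q \<otimes> inv p\<close>. In either case \<open>D\<close> determines \<open>b\<close>, and
  \<open>b\<close> determines the point or the line. For a quadrangle take two lines and two points on each, away
  from the intersection.\<close>

lemma translates_projective_plane:
  assumes inf: "infinite (carrier G)" and pds: "perfect_difference_set D"
  shows "projective_plane (carrier G) ((\<lambda>x. x <# D) ` carrier G) (\<in>)"
proof -
  have D: "D \<subseteq> carrier G"
    and unique: "\<And>g. \<lbrakk>g \<in> carrier G; g \<noteq> \<one>\<rbrakk> \<Longrightarrow> \<exists>!b. b \<in> D \<and> g \<otimes> b \<in> D"
    using pds unfolding perfect_difference_set_def by blast+
  have meet: "\<exists>!p. p \<in> carrier G \<and> p \<in> x <# D \<and> p \<in> y <# D"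
    if xy: "x \<in> carrier G" "y \<in> carrier G" "x \<noteq> y" for x y
  proof -
    define g where "g = inv y \<otimes> x"
    have g: "g \<in> carrier G" "g \<noteq> \<one>"
      using xy inv_equality by (auto simp: g_def) (metis inv_closed inv_inv)
    have shift: "inv y \<otimes> p = g \<otimes> (inv x \<otimes> p)" if "p \<in> carrier G" for p
    proof -
      have "x \<otimes> (inv x \<otimes> p) = p" using xy that by (simp add: m_assoc[symmetric])
      then show ?thesis using xy that by (simp add: g_def m_assoc)
    qed
    obtain b where b: "b \<in> D" "g \<otimes> b \<in> D" and uniq: "\<And>c. \<lbrakk>c \<in> D; g \<otimes> c \<in> D\<rbrakk> \<Longrightarrow> c = b"
      using unique[OF g] by blast
    have bG: "b \<in> carrier G" using b D by blast
    show ?thesis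
    proof (rule ex1I[of _ "x \<otimes> b"])
      have "inv x \<otimes> (x \<otimes> b) = b" using xy bG by (simp add: m_assoc[symmetric])
      then show "x \<otimes> b \<in> carrier G \<and> x \<otimes> b \<in> x <# D \<and> x \<otimes> b \<in> y <# D"
        using b bG xy shift[of "x \<otimes> b"] by (simp add: mem_l_coset_iff[OF D])
    next
      fix p assume p: "p \<in> carrier G \<and> p \<in> x <# D \<and> p \<in> y <# D"
      then have "inv x \<otimes> p = b"
        using xy by (intro uniq) (auto simp add: mem_l_coset_iff[OF D] simp flip: shift)
      then show "p = x \<otimes> b" using p xy by (auto simp: m_assoc[symmetric])
    qed
  qed
  have join: "\<exists>!l. l \<in> (\<lambda>x. x <# D) ` carrier G \<and> p \<in> l \<and> q \<in> l"
    if pq: "p \<in> carrier G" "q \<in> carrier G" "p \<noteq> q" for p q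
  proof -
    define g where "g = q \<otimes> inv p"
    have g: "g \<in> carrier G" "g \<noteq> \<one>"
      using pq inv_equality by (auto simp: g_def) (metis inv_closed inv_inv)
    have shift: "inv x \<otimes> q = g \<otimes> (inv x \<otimes> p)" if "x \<in> carrier G" for x
    proof -
      have "inv p \<otimes> (p \<otimes> inv x) = inv x" using pq that by (simp add: m_assoc[symmetric])
      then show ?thesis using pq that
        by (simp add: g_def m_assoc m_comm[of "inv x" p] m_comm[of "inv x" q])
    qed
    obtain b where b: "b \<in> D" "g \<otimes> b \<in> D" and uniq: "\<And>c. \<lbrakk>c \<in> D; g \<otimes> c \<in> D\<rbrakk> \<Longrightarrow> c = b"
      using unique[OF g] by blast
    have bG: "b \<in> carrier G" using b D by blast
    define x where "x = p \<otimes> inv b"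
    have x: "x \<in> carrier G" using pq bG by (simp add: x_def)
    have xp: "inv x \<otimes> p = b" using pq bG by (simp add: x_def inv_mult m_ac)
    show ?thesis
    proof (rule ex1I[of _ "x <# D"])
      show "x <# D \<in> (\<lambda>x. x <# D) ` carrier G \<and> p \<in> x <# D \<and> q \<in> x <# D"
        using b x pq xp shift[OF x] by (simp add: mem_l_coset_iff[OF D])
    next
      fix l assume l: "l \<in> (\<lambda>x. x <# D) ` carrier G \<and> p \<in> l \<and> q \<in> l"
      then obtain y where y: "y \<in> carrier G" "l = y <# D" by blast
      then have "inv y \<otimes> p = b"
        using l pq by (intro uniq) (auto simp add: mem_l_coset_iff[OF D] simp flip: shift)
      then have "p = y \<otimes> b" using y pq by (auto simp: m_assoc[symmetric])
      then have "x = y" using y bG by (simp add: x_def m_assoc)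
      then show "l = x <# D" using y by simp
    qed
  qed
  have infinite_line: "infinite (x <# D)" if "x \<in> carrier G" for x
  proof -
    have "inj_on (\<lambda>d. x \<otimes> d) D" using D that by (intro inj_onI) (meson l_cancel subsetD)
    moreover have "x <# D = (\<lambda>d. x \<otimes> d) ` D" by (auto simp: l_coset_def)
    ultimately show ?thesis
      using perfect_difference_set_infinite[OF inf pds] finite_imageD by metis
  qed
  have line_sub: "l \<subseteq> carrier G" if "l \<in> (\<lambda>x. x <# D) ` carrier G" for l
    using that D l_coset_subset_G by blast
  show ?thesis
  proof
    fix p q assume "p \<in> carrier G" "q \<in> carrier G" "p \<noteq> q"
    then show "\<exists>!l. l \<in> (\<lambda>x. x <# D) ` carrier G \<and> p \<in> l \<and> q \<in> l" by (rule join)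
  next
    fix l m assume "l \<in> (\<lambda>x. x <# D) ` carrier G" "m \<in> (\<lambda>x. x <# D) ` carrier G" "l \<noteq> m"
    then show "\<exists>!p. p \<in> carrier G \<and> p \<in> l \<and> p \<in> m" using meet by blast
  next
    obtain y where y: "y \<in> carrier G" "y \<noteq> \<one>"
      using inf by (metis finite.emptyI finite_insert finite_subset singletonI subsetI)
    define l m where "l = \<one> <# D" and "m = y <# D"
    have lm: "l \<in> (\<lambda>x. x <# D) ` carrier G" "m \<in> (\<lambda>x. x <# D) ` carrier G"
      using y by (auto simp: l_def m_def)
    obtain p where p: "\<And>q. q \<in> l \<Longrightarrow> q \<in> m \<Longrightarrow> q = p"
      using meet[of \<one> y] y line_sub lm unfolding l_def m_def by (metis one_closed subsetD)
    have two: "\<exists>a b. a \<in> k \<and> b \<in> k \<and> a \<noteq> b \<and> a \<noteq> p \<and> b \<noteq> p" if "infinite k" for k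
    proof -
      have "infinite (k - {p})" using that by simp
      then obtain a where a: "a \<in> k - {p}" by (metis equals0I finite.emptyI)
      have "infinite (k - {p} - {a})" using that by simp
      then obtain b where "b \<in> k - {p} - {a}" by (metis equals0I finite.emptyI)
      then show ?thesis using a by blast
    qed
    obtain a b where ab: "a \<in> l" "b \<in> l" "a \<noteq> b" "a \<noteq> p" "b \<noteq> p"
      using two[OF infinite_line[of \<one>]] unfolding l_def by auto
    obtain c d where cd: "c \<in> m" "d \<in> m" "c \<noteq> d" "c \<noteq> p" "d \<noteq> p"
      using two[OF infinite_line[of y]] y unfolding m_def by auto
    have off: "a \<notin> m" "b \<notin> m" "c \<notin> l" "d \<notin> l" using ab cd p by blast+
    let ?Q = "{a, b, c, d}"
    have "a \<notin> {b, c, d}" "b \<notin> {c, d}" "c \<noteq> d" using ab cd off by blast+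
    then have "card ?Q = 4" by simp
    moreover have "card {q \<in> ?Q. q \<in> k} \<le> 2" if k: "k \<in> (\<lambda>x. x <# D) ` carrier G" for k
    proof -
      have l: "k = l" if "a \<in> k" "b \<in> k"
        using join[of a b] that ab lm k line_sub by blast
      have m: "k = m" if "c \<in> k" "d \<in> k"
        using join[of c d] that cd lm k line_sub by blast
      have le2: "card A \<le> 2" if "A \<subseteq> {u, v}" for A and u v :: 'a
        using card_mono[OF _ that] card_insert_le_m1[of 2 "{v}" u] by simp
      consider "a \<in> k" "b \<in> k" | "c \<in> k" "d \<in> k" | "a \<notin> k \<or> b \<notin> k" "c \<notin> k \<or> d \<notin> k" by blast
      then show ?thesis
      proof cases
        case 1 then show ?thesis using l off by (intro le2[of _ a b]) auto
      next
        case 2 then show ?thesis using m off by (intro le2[of _ c d]) auto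
      next
        case 3
        then have "\<exists>u v. {q \<in> ?Q. q \<in> k} \<subseteq> {u, v}" by blast
        then show ?thesis using le2 by blast
      qed
    qed
    moreover have "?Q \<subseteq> carrier G" using ab cd lm line_sub by blast
    ultimately show "\<exists>Q \<subseteq> carrier G. card Q = 4 \<and>
        (\<forall>k \<in> (\<lambda>x. x <# D) ` carrier G. card {q \<in> Q. q \<in> k} \<le> 2)"
      by blast
  qed
qed

lemma perfect_difference_set_singer_action:
  assumes inf: "infinite (carrier G)" and pds: "perfect_difference_set D"
  shows "singer_action G (carrier G) ((\<lambda>x. x <# D) ` carrier G) (\<in>) (\<lambda>g. \<lambda>x \<in> carrier G. g \<otimes> x)"
proof -
  let ?\<phi> = "\<lambda>g. \<lambda>x \<in> carrier G. g \<otimes> x" and ?L = "(\<lambda>x. x <# D) ` carrier G"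
  have D: "D \<subseteq> carrier G" using pds unfolding perfect_difference_set_def by blast
  have bij: "bij_betw (?\<phi> g) (carrier G) (carrier G)" if "g \<in> carrier G" for g
    by (rule bij_betw_byWitness[where f' = "\<lambda>x. inv g \<otimes> x"])
      (use that in \<open>auto simp: m_assoc[symmetric]\<close>)
  have action: "group_action G (carrier G) ?\<phi>"
  proof (intro group_action.intro group_hom.intro group_hom_axioms.intro group_BijGroup is_group)
    show "?\<phi> \<in> hom G (BijGroup (carrier G))"
      using bij by (auto simp: hom_def BijGroup_def Bij_def compose_def m_assoc intro!: restrict_ext)
  qed
  have coll: "collineation (carrier G) ?L (\<in>) (?\<phi> g)" if g: "g \<in> carrier G" for g
    unfolding collineation_def
  proof (intro conjI exI[of _ "\<lambda>l. g <# l"] ballI)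
    show "bij_betw (?\<phi> g) (carrier G) (carrier G)" by (rule bij[OF g])
    have sub: "x <# D \<subseteq> carrier G" if "x \<in> carrier G" for x using l_coset_subset_G D that by blast
    show "bij_betw (\<lambda>l. g <# l) ?L ?L"
      by (rule bij_betw_byWitness[where f' = "\<lambda>l. inv g <# l"])
        (use g D sub in \<open>auto simp: lcos_m_assoc m_assoc[symmetric]\<close>)
    fix p l assume p: "p \<in> carrier G" and l: "l \<in> ?L"
    have "inv g \<otimes> (g \<otimes> p) = p" using g p by (simp add: m_assoc[symmetric])
    then show "p \<in> l \<longleftrightarrow> ?\<phi> g p \<in> g <# l"
      using g p l sub by (auto simp: mem_l_coset_iff)
  qed
  have sharp: "\<exists>!g. g \<in> carrier G \<and> ?\<phi> g x = y" if "x \<in> carrier G" "y \<in> carrier G" for x y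
  proof (rule ex1I[of _ "y \<otimes> inv x"])
    fix g assume "g \<in> carrier G \<and> ?\<phi> g x = y"
    then show "g = y \<otimes> inv x" using that by (auto simp: m_assoc)
  qed (use that in \<open>simp add: m_assoc\<close>)
  show ?thesis
    by (intro singer_action.intro action translates_projective_plane[OF inf pds]
        singer_action_axioms.intro coll sharp)
qed

end

theorem theorem5p1:
  fixes G :: "('a, 'b) monoid_scheme"
  assumes "comm_group G" and "infinite (carrier G)"
  shows "acts_as_singer_group G \<longleftrightarrow> (\<nexists>x. involution G x)"
proof
  assume "acts_as_singer_group G"
  then obtain P :: "'a set" and L :: "'a set set" and incid \<phi> where singer: "singer_action G P L incid \<phi>"
    unfolding acts_as_singer_group_def by blast
  show "\<nexists>x. involution G x" using singer_group_no_involution[OF singer] by simp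
next
  interpret comm_group G by fact
  assume "\<nexists>x. involution G x"
  then obtain D where "perfect_difference_set D"
    using perfect_difference_set_exists assms(2) by blast
  then show "acts_as_singer_group G"
    using perfect_difference_set_singer_action assms(2) unfolding acts_as_singer_group_def by blast
qed

end
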